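(* Let $k\in[0,1)$ and let $S$ be a weakly regular AG-groupoid with left identity $e$. Then the following conditions are equivalent: (i) $S$ is regular. (ii) $(f\wedge_k g)\wedge_k h\le (f\circ_k g)\circ_k h$ for every $(\in,\in\vee q_k)$-fuzzy right ideal $f$, every $(\in,\in\vee q_k)$-fuzzy generalized bi-ideal $g$ and every $(\in,\in\vee q_k)$-fuzzy left ideal $h$ of $S$. (iii) $(f\wedge_k g)\wedge_k h\le (f\circ_k g)\circ_k h$ for every $(\in,\in\vee q_k)$-fuzzy right ideal $f$, every $(\in,\in\vee q_k)$-fuzzy bi-ideal $g$ and every $(\in,\in\vee q_k)$-fuzzy left ideal $h$ of $S$. (iv) $(f\wedge_k g)\wedge_k h\le (f\circ_k g)\circ_k h$ for every $(\in,\in\vee q_k)$-fuzzy right ideal $f$, every $(\in,\in\vee q_k)$-fuzzy quasi-ideal $g$ and every $(\in,\in\vee q_k)$-fuzzy left ideal $h$ of $S$.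
   Context: An AG-groupoid is a (non-empty) set $S$ with a binary operation satisfying $(ab)c=(cb)a$ for all $a,b,c\in S$. A left identity is an element $e$ with $ea=a$ for all $a$. $S$ is weakly regular if for each $a\in S$ there are $x,y\in S$ with $a=(ax)(ay)$; $S$ is regular if for each $a\in S$ there is $x\in S$ with $a=(ax)a$. A fuzzy subset of $S$ is a map $f:S\to[0,1]$; $\wedge$ denotes minimum, and $f\le g$ is meant pointwise. $1$ denotes the constant fuzzy subset with value $1$. The product is $(f\circ g)(a)=\sup_{a=bc}\, (f(b)\wedge g(c))$ (supremum over all $b,c\in S$ with $a=bc$), and $(f\circ g)(a)=0$ if $a$ is not a product of two elements. Further, $(f\wedge_k g)(a)=f(a)\wedge g(a)\wedge\frac{1-k}{2}$ and $(f\circ_k g)(a)=(f\circ g)(a)\wedge\frac{1-k}{2}$. For $x\in S$, $t\in(0,1]$: $x_t\in f$ means $f(x)\ge t$; $x_t q_k f$ means $f(x)+t+k>1$; $x_t\in\vee q_k f$ means $x_t\in f$ or $x_tq_kf$. A fuzzy subset $f$ is an $(\in,\in\vee q_k)$-fuzzy: - left (right) ideal if $y_t\in f$ implies $(xy)_t\in\vee q_k f$ (respectively $(yx)_t\in\vee q_kf$) for all $x,y\in S$, $t\in(0,1]$; equivalently $f(xy)\ge f(y)\wedge\frac{1-k}{2}$ (respectively $f(xy)\ge f(x)\wedge\frac{1-k}{2}$) for all $x,y$; - subgroupoid if $x_t\in f$ and $y_r\in f$ imply $(xy)_{t\wedge r}\in\vee q_kf$; equivalently $f(xy)\ge f(x)\wedge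 f(y)\wedge\frac{1-k}{2}$ for all $x,y$; - generalized bi-ideal if $x_t\in f$ and $z_r\in f$ imply $((xy)z)_{t\wedge r}\in\vee q_kf$ for all $y$; equivalently $f((xy)z)\ge f(x)\wedge f(z)\wedge\frac{1-k}{2}$ for all $x,y,z$; - bi-ideal if it is both an $(\in,\in\vee q_k)$-fuzzy subgroupoid and an $(\in,\in\vee q_k)$-fuzzy generalized bi-ideal; - quasi-ideal if $f(x)\ge (f\circ 1)(x)\wedge(1\circ f)(x)\wedge\frac{1-k}{2}$ for all $x$. *)

theory Defs
  imports Complex_Main "HOL-Library.FuncSet"
begin

definition ag_groupoid :: "'a set \<Rightarrow> ('a \<Rightarrow> 'a \<Rightarrow> 'a) \<Rightarrow> bool" where
  "ag_groupoid S m \<longleftrightarrow>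
     S \<noteq> {} \<and> (\<forall>a\<in>S. \<forall>b\<in>S. m a b \<in> S) \<and>
     (\<forall>a\<in>S. \<forall>b\<in>S. \<forall>c\<in>S. m (m a b) c = m (m c b) a)"

definition left_identity :: "'a set \<Rightarrow> ('a \<Rightarrow> 'a \<Rightarrow> 'a) \<Rightarrow> 'a \<Rightarrow> bool" where
  "left_identity S m e \<longleftrightarrow> e \<in> S \<and> (\<forall>a\<in>S. m e a = a)"

definition weakly_regular :: "'a set \<Rightarrow> ('a \<Rightarrow> 'a \<Rightarrow> 'a) \<Rightarrow> bool" where
  "weakly_regular S m \<longleftrightarrow> (\<forall>a\<in>S. \<exists>x\<in>S. \<exists>y\<in>S. a = m (m a x) (m a y))"

definition regular :: "'a set \<Rightarrow> ('a \<Rightarrow> 'a \<Rightarrow> 'a) \<Rightarrow> bool" where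
  "regular S m \<longleftrightarrow> (\<forall>a\<in>S. \<exists>x\<in>S. a = m (m a x) a)"

text \<open>A fuzzy subset of \<open>S\<close> is represented by a total function; only its values on \<open>S\<close>
  are ever used.\<close>

definition fuzzy_subset :: "'a set \<Rightarrow> ('a \<Rightarrow> real) \<Rightarrow> bool" where
  "fuzzy_subset S f \<longleftrightarrow> f \<in> S \<rightarrow> {0..1}"

definition fuzzy_le :: "'a set \<Rightarrow> ('a \<Rightarrow> real) \<Rightarrow> ('a \<Rightarrow> real) \<Rightarrow> bool" where
  "fuzzy_le S f g \<longleftrightarrow> (\<forall>x\<in>S. f x \<le> g x)"

definition fuzzy_one :: "'a \<Rightarrow> real" where
  "fuzzy_one = (\<lambda>_. 1)"

text \<open>The case distinction is needed because \<^term>\<open>Sup {} :: real\<close> is unspecified.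
  For fuzzy subsets the set below is bounded by 1, so \<^const>\<open>Sup\<close> is the true supremum
  when it is non-empty.\<close>

definition fuzzy_prod ::
  "'a set \<Rightarrow> ('a \<Rightarrow> 'a \<Rightarrow> 'a) \<Rightarrow> ('a \<Rightarrow> real) \<Rightarrow> ('a \<Rightarrow> real) \<Rightarrow> 'a \<Rightarrow> real" where
  "fuzzy_prod S m f g a =
     (if \<exists>b\<in>S. \<exists>c\<in>S. a = m b c
      then Sup {min (f b) (g c) | b c. b \<in> S \<and> c \<in> S \<and> a = m b c}
      else 0)"

definition fuzzy_meet_k :: "real \<Rightarrow> ('a \<Rightarrow> real) \<Rightarrow> ('a \<Rightarrow> real) \<Rightarrow> 'a \<Rightarrow> real" where
  "fuzzy_meet_k k f g a = min (min (f a) (g a)) ((1 - k) / 2)"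

definition fuzzy_prod_k ::
  "'a set \<Rightarrow> ('a \<Rightarrow> 'a \<Rightarrow> 'a) \<Rightarrow> real \<Rightarrow> ('a \<Rightarrow> real) \<Rightarrow> ('a \<Rightarrow> real) \<Rightarrow> 'a \<Rightarrow> real" where
  "fuzzy_prod_k S m k f g a = min (fuzzy_prod S m f g a) ((1 - k) / 2)"

text \<open>A fuzzy point \<open>x\<^sub>t\<close> is given by its support \<open>x\<close> and its value \<open>t\<close>.\<close>

definition point_in :: "'a \<Rightarrow> real \<Rightarrow> ('a \<Rightarrow> real) \<Rightarrow> bool" where
  "point_in x t f \<longleftrightarrow> f x \<ge> t"

definition point_q :: "real \<Rightarrow> 'a \<Rightarrow> real \<Rightarrow> ('a \<Rightarrow> real) \<Rightarrow> bool" where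
  "point_q k x t f \<longleftrightarrow> f x + t + k > 1"

definition point_in_or_q :: "real \<Rightarrow> 'a \<Rightarrow> real \<Rightarrow> ('a \<Rightarrow> real) \<Rightarrow> bool" where
  "point_in_or_q k x t f \<longleftrightarrow> point_in x t f \<or> point_q k x t f"

definition fuzzy_left_ideal ::
  "'a set \<Rightarrow> ('a \<Rightarrow> 'a \<Rightarrow> 'a) \<Rightarrow> real \<Rightarrow> ('a \<Rightarrow> real) \<Rightarrow> bool" where
  "fuzzy_left_ideal S m k f \<longleftrightarrow> fuzzy_subset S f \<and>
     (\<forall>x\<in>S. \<forall>y\<in>S. \<forall>t\<in>{0<..1}. point_in y t f \<longrightarrow> point_in_or_q k (m x y) t f)"

definition fuzzy_right_ideal ::
  "'a set \<Rightarrow> ('a \<Rightarrow> 'a \<Rightarrow> 'a) \<Rightarrow> real \<Rightarrow> ('a \<Rightarrow> real) \<Rightarrow> bool" where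
  "fuzzy_right_ideal S m k f \<longleftrightarrow> fuzzy_subset S f \<and>
     (\<forall>x\<in>S. \<forall>y\<in>S. \<forall>t\<in>{0<..1}. point_in y t f \<longrightarrow> point_in_or_q k (m y x) t f)"

definition fuzzy_subgroupoid ::
  "'a set \<Rightarrow> ('a \<Rightarrow> 'a \<Rightarrow> 'a) \<Rightarrow> real \<Rightarrow> ('a \<Rightarrow> real) \<Rightarrow> bool" where
  "fuzzy_subgroupoid S m k f \<longleftrightarrow> fuzzy_subset S f \<and>
     (\<forall>x\<in>S. \<forall>y\<in>S. \<forall>t\<in>{0<..1}. \<forall>r\<in>{0<..1}.
        point_in x t f \<and> point_in y r f \<longrightarrow> point_in_or_q k (m x y) (min t r) f)"

definition fuzzy_generalized_bi_ideal ::
  "'a set \<Rightarrow> ('a \<Rightarrow> 'a \<Rightarrow> 'a) \<Rightarrow> real \<Rightarrow> ('a \<Rightarrow> real) \<Rightarrow> bool" where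
  "fuzzy_generalized_bi_ideal S m k f \<longleftrightarrow> fuzzy_subset S f \<and>
     (\<forall>x\<in>S. \<forall>y\<in>S. \<forall>z\<in>S. \<forall>t\<in>{0<..1}. \<forall>r\<in>{0<..1}.
        point_in x t f \<and> point_in z r f \<longrightarrow> point_in_or_q k (m (m x y) z) (min t r) f)"

definition fuzzy_bi_ideal ::
  "'a set \<Rightarrow> ('a \<Rightarrow> 'a \<Rightarrow> 'a) \<Rightarrow> real \<Rightarrow> ('a \<Rightarrow> real) \<Rightarrow> bool" where
  "fuzzy_bi_ideal S m k f \<longleftrightarrow>
     fuzzy_subgroupoid S m k f \<and> fuzzy_generalized_bi_ideal S m k f"

definition fuzzy_quasi_ideal ::
  "'a set \<Rightarrow> ('a \<Rightarrow> 'a \<Rightarrow> 'a) \<Rightarrow> real \<Rightarrow> ('a \<Rightarrow> real) \<Rightarrow> bool" where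
  "fuzzy_quasi_ideal S m k f \<longleftrightarrow> fuzzy_subset S f \<and>
     (\<forall>x\<in>S. f x \<ge> min (min (fuzzy_prod S m f fuzzy_one x) (fuzzy_prod S m fuzzy_one f x))
                       ((1 - k) / 2))"

end

theory Submission imports Defs begin

text \<open>
  In the presence of a left identity, weak regularity already implies regularity, so (i) is
  automatic and only the inequalities need proof. Weak regularity and the medial law give
  \<open>a = (aa)u\<close>. The element \<open>i = ua\<close> then equals \<open>au\<close>, is idempotent and satisfies \<open>ia = a\<close>, so that
  \<open>a = (aa)(iu)\<close> with \<open>iu = (au)u = (uu)a\<close>. This factorisation \<open>a = (aa)((uu)a)\<close> yields all three
  inequalities at once: only the last factor has to be compared with \<open>a\<close>, by the left ideal
  property of \<open>h\<close>.
\<close>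

locale ag_groupoid_left_identity =
  fixes S :: "'a set" and m :: "'a \<Rightarrow> 'a \<Rightarrow> 'a" (infixl "\<cdot>" 70) and e :: 'a
  assumes ag: "ag_groupoid S m" and left_id: "left_identity S m e"
begin

lemma closed [simp, intro]: "a \<in> S \<Longrightarrow> b \<in> S \<Longrightarrow> a \<cdot> b \<in> S"
  using ag by (simp add: ag_groupoid_def)

lemma left_invertive: "a \<in> S \<Longrightarrow> b \<in> S \<Longrightarrow> c \<in> S \<Longrightarrow> (a \<cdot> b) \<cdot> c = (c \<cdot> b) \<cdot> a"
  using ag unfolding ag_groupoid_def by blast

lemma e_closed [simp, intro]: "e \<in> S" and e_left: "a \<in> S \<Longrightarrow> e \<cdot> a = a"
  using left_id by (auto simp: left_identity_def)

lemma medial: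
  assumes "a \<in> S" "b \<in> S" "c \<in> S" "d \<in> S"
  shows "(a \<cdot> b) \<cdot> (c \<cdot> d) = (a \<cdot> c) \<cdot> (b \<cdot> d)"
proof -
  have "(a \<cdot> b) \<cdot> (c \<cdot> d) = ((c \<cdot> d) \<cdot> b) \<cdot> a"
    using assms by (intro left_invertive) auto
  also have "(c \<cdot> d) \<cdot> b = (b \<cdot> d) \<cdot> c"
    using assms by (intro left_invertive) auto
  also have "((b \<cdot> d) \<cdot> c) \<cdot> a = (a \<cdot> c) \<cdot> (b \<cdot> d)"
    using assms by (intro left_invertive) auto
  finally show ?thesis .
qed

text \<open>The medial law applied to \<open>(e \<cdot> a) \<cdot> (b \<cdot> c)\<close>, with
  \<open>e\<close> absorbed on both sides.\<close>

lemma left_permute: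
  assumes "a \<in> S" "b \<in> S" "c \<in> S"
  shows "a \<cdot> (b \<cdot> c) = b \<cdot> (a \<cdot> c)"
  using medial[of e a b c] assms by (simp add: e_left)

text \<open>Both sides are reshufflings of \<open>(a \<cdot> b) \<cdot> (a \<cdot> b)\<close>. The
  operation itself need not be commutative.\<close>

lemma square_commute:
  assumes "a \<in> S" "b \<in> S"
  shows "(a \<cdot> a) \<cdot> (b \<cdot> b) = (b \<cdot> b) \<cdot> (a \<cdot> a)"
proof -
  have "(a \<cdot> a) \<cdot> (b \<cdot> b) = (a \<cdot> b) \<cdot> (a \<cdot> b)"
    using assms by (intro medial) auto
  also have "\<dots> = a \<cdot> ((a \<cdot> b) \<cdot> b)"
    using assms by (intro left_permute) auto
  also have "(a \<cdot> b) \<cdot> b = (b \<cdot> b) \<cdot> a"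
    using assms by (intro left_invertive) auto
  also have "a \<cdot> ((b \<cdot> b) \<cdot> a) = (b \<cdot> b) \<cdot> (a \<cdot> a)"
    using assms by (intro left_permute) auto
  finally show ?thesis .
qed

context
  assumes wr: "weakly_regular S m"
begin

text \<open>The medial law collects the two copies of \<open>a\<close> in
  \<open>(a \<cdot> x) \<cdot> (a \<cdot> y)\<close>, so \<open>u = x \<cdot> y\<close>
  works.\<close>

lemma obtain_quotient:
  assumes "a \<in> S"
  obtains u where "u \<in> S" "a = (a \<cdot> a) \<cdot> u"
proof -
  obtain x y where "x \<in> S" "y \<in> S" "a = (a \<cdot> x) \<cdot> (a \<cdot> y)"
    using wr assms unfolding weakly_regular_def by blast
  with assms medial[of a x a y] that[of "x \<cdot> y"] show thesis by auto
qed

text \<open>Expanding the factor \<open>a\<close> of \<open>a \<cdot> u\<close> produces the squares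
  of \<open>a\<close> and \<open>u\<close>; once these are swapped, pulling one \<open>u\<close> to
  the front reassembles \<open>a\<close> behind it.\<close>

lemma quotient_commute:
  assumes "a \<in> S" "u \<in> S" and a: "a = (a \<cdot> a) \<cdot> u"
  shows "a \<cdot> u = u \<cdot> a"
proof -
  have "a \<cdot> u = ((a \<cdot> a) \<cdot> u) \<cdot> u"
    using a by simp
  also have "\<dots> = (u \<cdot> u) \<cdot> (a \<cdot> a)"
    using assms(1,2) by (intro left_invertive) auto
  also have "\<dots> = (a \<cdot> a) \<cdot> (u \<cdot> u)"
    using assms(1,2) by (rule square_commute[symmetric])
  also have "\<dots> = u \<cdot> ((a \<cdot> a) \<cdot> u)"
    using assms(1,2) by (intro left_permute) auto
  also have "\<dots> = u \<cdot> a"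
    using a by simp
  finally show ?thesis .
qed

lemma regular: "regular S m"
  unfolding regular_def
proof
  fix a assume "a \<in> S"
  then obtain u where u: "u \<in> S" "a = (a \<cdot> a) \<cdot> u"
    by (rule obtain_quotient)
  \<comment> \<open>The left invertive law turns \<open>(a \<cdot> a) \<cdot> u\<close> into
    \<open>(u \<cdot> a) \<cdot> a\<close>, and \<open>u\<close> commutes with
    \<open>a\<close>.\<close>
  have "a = (a \<cdot> u) \<cdot> a"
    using u \<open>a \<in> S\<close> quotient_commute left_invertive by metis
  with u show "\<exists>x\<in>S. a = (a \<cdot> x) \<cdot> a" by blast
qed

lemma weakly_regular_factorization:
  assumes "a \<in> S"
  obtains v where "v \<in> S" "a = (a \<cdot> a) \<cdot> (v \<cdot> a)"
proof -
  obtain u where u: "u \<in> S" "a = (a \<cdot> a) \<cdot> u"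
    using assms by (rule obtain_quotient)
  define i where "i = a \<cdot> u"
  have i: "i \<in> S" "i = u \<cdot> a"
    using assms u quotient_commute[of a u] by (auto simp: i_def)
  have ia: "i \<cdot> a = a"
    using left_invertive[of u a a] assms u i by simp
  have "i \<cdot> i = (a \<cdot> a) \<cdot> (u \<cdot> u)"
    unfolding i_def using assms u(1) by (intro medial) auto
  also have "\<dots> = u \<cdot> ((a \<cdot> a) \<cdot> u)"
    using assms u(1) by (intro left_permute) auto
  also have "\<dots> = i"
    using u i by simp
  finally have ii: "i \<cdot> i = i" .
  have "(a \<cdot> a) \<cdot> ((u \<cdot> u) \<cdot> a) = (a \<cdot> a) \<cdot> (i \<cdot> u)"
    using left_invertive[of u u a] assms u(1) by (simp add: i_def)
  \<comment> \<open>The medial law exchanges the inner \<open>a\<close> and \<open>i\<close>, and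
    the new right factor \<open>a \<cdot> u\<close> is again \<open>i\<close>.\<close>
  also have "\<dots> = (a \<cdot> i) \<cdot> i"
    using medial[of a a i u] assms u(1) i(1) by (simp add: i_def)
  also have "\<dots> = (i \<cdot> i) \<cdot> a"
    using assms i(1) by (intro left_invertive) auto
  also have "\<dots> = a"
    using ii ia by simp
  finally show thesis
    using that[of "u \<cdot> u"] u(1) by auto
qed

end

end

lemma fuzzy_prod_ge:
  assumes "fuzzy_subset S g" "b \<in> S" "c \<in> S"
  shows "min (f b) (g c) \<le> fuzzy_prod S m f g (m b c)"
proof -
  let ?A = "{min (f b') (g c') | b' c'. b' \<in> S \<and> c' \<in> S \<and> m b c = m b' c'}"
  \<comment> \<open>\<open>Sup\<close> dominates its members only for a set bounded above; the bound
    1 comes from the second entry of each minimum.\<close>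
  have "bdd_above ?A"
  proof (rule bdd_aboveI)
    fix x assume "x \<in> ?A"
    then show "x \<le> 1"
      using assms(1) by (fastforce simp: fuzzy_subset_def Pi_iff min_le_iff_disj)
  qed
  moreover have "min (f b) (g c) \<in> ?A"
    using assms by blast
  ultimately have "min (f b) (g c) \<le> Sup ?A"
    by (simp add: cSup_upper)
  then show ?thesis
    using assms by (auto simp: fuzzy_prod_def)
qed

text \<open>The pointwise form follows by testing the definition at the single level
  \<open>min (f y) ((1 - k) / 2)\<close>.\<close>

lemma fuzzy_left_ideal_ge:
  assumes "fuzzy_left_ideal S m k f" "k < 1" "x \<in> S" "y \<in> S" "m x y \<in> S"
  shows "min (f y) ((1 - k) / 2) \<le> f (m x y)"
proof -
  let ?t = "min (f y) ((1 - k) / 2)"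
  have f: "f y \<in> {0..1}" "f (m x y) \<in> {0..1}"
    using assms by (auto simp: fuzzy_left_ideal_def fuzzy_subset_def)
  show ?thesis
  \<comment> \<open>Levels of fuzzy points are positive; otherwise the claim is just nonnegativity
    of \<open>f\<close>.\<close>
  proof (cases "?t > 0")
    case True
    with f have "?t \<in> {0<..1}" by auto
    moreover have "point_in y ?t f" by (simp add: point_in_def)
    ultimately have "point_in_or_q k (m x y) ?t f"
      using assms unfolding fuzzy_left_ideal_def by blast
    then have "?t \<le> f (m x y) \<or> f (m x y) > 1 - k - ?t"
      by (auto simp: point_in_or_q_def point_in_def point_q_def)
    \<comment> \<open>In the \<open>point_q\<close> case this gives
      \<open>1 - k - ?t \<ge> (1 - k) / 2 \<ge> ?t\<close>.\<close>
    moreover have "?t \<le> (1 - k) / 2" by (rule min.cobounded2)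
    ultimately show ?thesis by argo
  qed (use f in auto)
qed

lemma (in ag_groupoid_left_identity) fuzzy_meet_k_le_prod_k:
  assumes "weakly_regular S m" "k < 1"
    and g: "fuzzy_subset S g" and h: "fuzzy_left_ideal S m k h"
  shows "fuzzy_le S (fuzzy_meet_k k (fuzzy_meet_k k f g) h)
           (fuzzy_prod_k S m k (fuzzy_prod_k S m k f g) h)"
  unfolding fuzzy_le_def
proof
  fix a assume a: "a \<in> S"
  obtain v where v: "v \<in> S" "a = (a \<cdot> a) \<cdot> (v \<cdot> a)"
    using assms(1) a by (rule weakly_regular_factorization)
  \<comment> \<open>The pair \<open>(a, a)\<close> is one of the factorisations of
    \<open>a \<cdot> a\<close>, and capping both sides at \<open>(1 - k) / 2\<close> preserves the
    inequality.\<close>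
  have "fuzzy_meet_k k f g a \<le> fuzzy_prod_k S m k f g (a \<cdot> a)"
    using fuzzy_prod_ge[OF g a a, of f m]
    unfolding fuzzy_meet_k_def fuzzy_prod_k_def by (rule min.mono) (rule order_refl)
  moreover have "min (h a) ((1 - k) / 2) \<le> h (v \<cdot> a)"
    using fuzzy_left_ideal_ge[OF h \<open>k < 1\<close>] a v(1) by auto
  moreover have "min (fuzzy_prod_k S m k f g (a \<cdot> a)) (h (v \<cdot> a))
      \<le> fuzzy_prod S m (fuzzy_prod_k S m k f g) h a"
    using fuzzy_prod_ge[of S h "a \<cdot> a" "v \<cdot> a" "fuzzy_prod_k S m k f g" m] h a v
    by (auto simp: fuzzy_left_ideal_def)
  \<comment> \<open>The cap lost in passing from \<open>h a\<close> to
    \<open>h (v \<cdot> a)\<close> costs nothing, since the outer meet already carries it.\<close>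
  ultimately show "fuzzy_meet_k k (fuzzy_meet_k k f g) h a
      \<le> fuzzy_prod_k S m k (fuzzy_prod_k S m k f g) h a"
    unfolding fuzzy_meet_k_def[of k "fuzzy_meet_k k f g"]
      fuzzy_prod_k_def[of S m k "fuzzy_prod_k S m k f g"] by linarith
qed

theorem theorem16:
  fixes S :: "'a set" and m :: "'a \<Rightarrow> 'a \<Rightarrow> 'a" and e :: 'a and k :: real
  assumes "0 \<le> k" and "k < 1"
    and "ag_groupoid S m"
    and "left_identity S m e"
    and "weakly_regular S m"
  shows
    "(regular S m \<longleftrightarrow>
        (\<forall>f g h. fuzzy_right_ideal S m k f \<and> fuzzy_generalized_bi_ideal S m k g \<and>
           fuzzy_left_ideal S m k h \<longrightarrow>
           fuzzy_le S (fuzzy_meet_k k (fuzzy_meet_k k f g) h)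
                      (fuzzy_prod_k S m k (fuzzy_prod_k S m k f g) h))) \<and>
     (regular S m \<longleftrightarrow>
        (\<forall>f g h. fuzzy_right_ideal S m k f \<and> fuzzy_bi_ideal S m k g \<and>
           fuzzy_left_ideal S m k h \<longrightarrow>
           fuzzy_le S (fuzzy_meet_k k (fuzzy_meet_k k f g) h)
                      (fuzzy_prod_k S m k (fuzzy_prod_k S m k f g) h))) \<and>
     (regular S m \<longleftrightarrow>
        (\<forall>f g h. fuzzy_right_ideal S m k f \<and> fuzzy_quasi_ideal S m k g \<and>
           fuzzy_left_ideal S m k h \<longrightarrow>
           fuzzy_le S (fuzzy_meet_k k (fuzzy_meet_k k f g) h)
                      (fuzzy_prod_k S m k (fuzzy_prod_k S m k f g) h)))"
proof -
  interpret ag_groupoid_left_identity S m e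
    using assms by unfold_locales
  \<comment> \<open>All three kinds of \<open>g\<close> are fuzzy subsets by definition, so this one
    inequality makes every right-hand side true, and regularity makes every left-hand side
    true.\<close>
  have "fuzzy_le S (fuzzy_meet_k k (fuzzy_meet_k k f g) h)
          (fuzzy_prod_k S m k (fuzzy_prod_k S m k f g) h)"
    if "fuzzy_subset S g" "fuzzy_left_ideal S m k h" for f g h
    using fuzzy_meet_k_le_prod_k assms that by blast
  moreover have "regular S m"
    using assms by (intro regular)
  ultimately show ?thesis
    by (simp add: fuzzy_generalized_bi_ideal_def fuzzy_bi_ideal_def fuzzy_subgroupoid_def
        fuzzy_quasi_ideal_def)
qed

end
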